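(* Let $H=\langle m_0,\dots,m_p,n\rangle$ be a numerical semigroup minimally generated by an almost arithmetic sequence, with associated data as in the context, and assume $W=\emptyset$. Suppose $r\ge2$. Then for every element $\gamma_k$ of $\mathrm{PF}(H)$, $k\in[p-r+2,p]$, letting $e\in[1,p-1]$ be defined by $r+k+e=2p+1$, there exists an $\mathrm{RF}$-matrix for $\gamma_k$ whose rows (indexed by $0,1,\dots,p,n$) are: (1) row $0$: $-E_0+qE_p+(v-1)E_n+E_{p-e}$; (2) row $j$ for $j\in[1,e]$: $-E_j+qE_p+(v-1)E_n+E_{p-e+j}$; (3) row $j$ for $j\in[e+1,p]$: $(\lambda-1)E_0-E_j+(w+v-1)E_n+E_{k+j-p-1}$; (4) row $n$: $(\mu-1)E_0+(q+q_z)E_p-E_n+E_{p-e}+E_{r_z}$ if $\mu\ge1$, and $(\lambda-1)E_0+(q_z-1)E_p-E_n+E_{k-1}+E_{r_z}$ if $\mu=0$.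
   Context: Notation: $\mathbb N=\{0,1,2,\dots\}$; $[a,b]$ is the set of integers $i$ with $a\le i\le b$. Let $p\ge1$, $d\ge1$, $m_0\ge 1$ be integers, $m_i=m_0+id$ for $i\in[0,p]$, and $n\ge1$ an integer with $\gcd(m_0,d,n)=1$. Put $H'=\sum_{i=0}^p\mathbb Nm_i$ and $H=H'+\mathbb Nn=\langle m_0,\dots,m_p,n\rangle$; assume $\{m_0,\dots,m_p,n\}$ is a minimal generating set of $H$. $\mathrm{Ap}(H,m_0)=\{h\in H: h-m_0\notin H\}$. For $t\in\mathbb N$ write $t=q_tp+r_t$ with $q_t\in\mathbb Z$, $r_t\in[1,p]$, and set $g_t=q_tm_p+m_{r_t}$ (so $q_0=-1$, $r_0=p$, $g_0=0$). Let $u=\min\{t\in\mathbb N: g_t\notin\mathrm{Ap}(H,m_0)\}$ and $v=\min\{b\ge1: bn\in H'\}$. It is known (Patil–Singh) that there are unique integers $z\in[0,u-1]$, $w\in[0,v-1]$, $\lambda\ge1$, $\mu\ge0$ with $g_u=\lambda m_0+wn$, $vn=\mu m_0+g_z$, and $g_{u-z}+(v-w)n=\nu m_0$, where $\nu=\lambda+\mu+1$ if $r_{u-z}<r_u$ and $\nu=\lambda+\mu$ if $r_{u-z}\ge r_u$. Set $r=r_u$, $q=q_u$, $r'=r_{u-z}$, $q'=q_{u-z}$, and $W=[u-z,u-1]\times[v-w,v-1]$ (empty iff $z=0$ or $w=0$). $\mathrm{PF}(H)$ is the set of $f\in\mathbb Z\setminus H$ with $f+h\in H$ for all $h\in H\setminus\{0\}$.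 An $\mathrm{RF}$-matrix for $f\in\mathrm{PF}(H)$ is a $(p+2)\times(p+2)$ integer matrix with rows and columns indexed by $0,1,\dots,p,n$ (corresponding to the generators $m_0,\dots,m_p,n$), with all diagonal entries $-1$, all off-diagonal entries in $\mathbb N$, and such that each row $(b_0,\dots,b_p,b_n)$ satisfies $\sum_{j=0}^p b_jm_j+b_nn=f$. $E_0,\dots,E_p,E_n$ denote the standard basis vectors of $\mathbb Z^{p+2}$ (coordinates indexed by $0,\dots,p,n$). Let $\gamma_k=g_{(q-1)p+r+k-1}+(v-1)n-m_0$ for $k\in[1,p]$. It is known (Patil–Sengupta) that if $W=\emptyset$, then $\mathrm{PF}(H)=\{\gamma_k: k\in[1,p]\}$ if $r=1$ and $\mathrm{PF}(H)=\{\gamma_k: k\in[p-r+2,p]\}$ if $r\ge2$. *)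

theory Defs
  imports Main "Jordan_Normal_Form.Matrix"
begin

text \<open>The sum of the sets \<open>\<nat> a\<^sub>i\<close> over \<open>i \<in> I\<close>; used for finite \<open>I\<close> only.\<close>
definition nat_span :: "(nat \<Rightarrow> int) \<Rightarrow> nat set \<Rightarrow> int set" where
  "nat_span a I = {\<Sum>i\<in>I. int (c i) * a i | c. True}"

text \<open>Minimality is stated for the indexed family, so the generators are in particular
  pairwise distinct.\<close>
definition minimally_generates :: "(nat \<Rightarrow> int) \<Rightarrow> nat set \<Rightarrow> int set \<Rightarrow> bool" where
  "minimally_generates a I H \<longleftrightarrow> nat_span a I = H \<and> (\<forall>J. J \<subset> I \<longrightarrow> nat_span a J \<noteq> H)"

definition Ap :: "int set \<Rightarrow> int \<Rightarrow> int set" where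
  "Ap H m = {h \<in> H. h - m \<notin> H}"

definition PF :: "int set \<Rightarrow> int set" where
  "PF H = {f. f \<notin> H \<and> (\<forall>h \<in> H - {0}. f + h \<in> H)}"

definition is_RF_matrix :: "nat \<Rightarrow> (nat \<Rightarrow> int) \<Rightarrow> int \<Rightarrow> int mat \<Rightarrow> bool" where
  "is_RF_matrix N a f A \<longleftrightarrow>
     f \<in> PF (nat_span a {..<N}) \<and>
     A \<in> carrier_mat N N \<and>
     (\<forall>i<N. A $$ (i, i) = -1) \<and>
     (\<forall>i<N. \<forall>j<N. i \<noteq> j \<longrightarrow> A $$ (i, j) \<ge> 0) \<and>
     (\<forall>i<N. (\<Sum>j<N. A $$ (i, j) * a j) = f)"

text \<open>The almost arithmetic sequence \<open>m\<^sub>0, \<dots>, m\<^sub>p, n\<close>: index \<open>i \<le> p\<close> stands for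
  \<open>m\<^sub>i = m\<^sub>0 + i d\<close>, and index \<open>p + 1\<close> for the generator \<open>n\<close>.\<close>
definition gens :: "nat \<Rightarrow> int \<Rightarrow> int \<Rightarrow> int \<Rightarrow> nat \<Rightarrow> int" where
  "gens p m0 d n i = (if i \<le> p then m0 + int i * d else n)"

definition H_arith :: "nat \<Rightarrow> int \<Rightarrow> int \<Rightarrow> int \<Rightarrow> int set" where
  "H_arith p m0 d n = nat_span (gens p m0 d n) {..p}"

definition H_full :: "nat \<Rightarrow> int \<Rightarrow> int \<Rightarrow> int \<Rightarrow> int set" where
  "H_full p m0 d n = nat_span (gens p m0 d n) {..<p + 2}"

text \<open>Division of \<open>t\<close> by \<open>p\<close> with remainder in \<open>[1, p]\<close>; the integer \<open>qt p 0\<close> is \<open>-1\<close>.\<close>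
definition qt :: "nat \<Rightarrow> nat \<Rightarrow> int" where
  "qt p t = (int t - 1) div int p"

definition rt :: "nat \<Rightarrow> nat \<Rightarrow> nat" where
  "rt p t = nat ((int t - 1) mod int p) + 1"

lemma qt_rt_iff:
  assumes "p \<ge> 1"
  shows "int t = q * int p + int r \<and> r \<in> {1..p} \<longleftrightarrow> q = qt p t \<and> r = rt p t"
proof
  assume h: "int t = q * int p + int r \<and> r \<in> {1..p}"
  then have eq: "int t - 1 = (int r - 1) + q * int p" by linarith
  have *: "0 \<le> int r - 1" "int r - 1 < int p" using h by auto
  have "(int t - 1) div int p = q" "(int t - 1) mod int p = int r - 1"
    using * unfolding eq by auto
  then show "q = qt p t \<and> r = rt p t" using h by (auto simp: qt_def rt_def)
next
  assume h: "q = qt p t \<and> r = rt p t"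
  let ?m = "(int t - 1) mod int p"
  have "0 \<le> ?m" "?m < int p" using assms by simp_all
  moreover have "int t - 1 = (int t - 1) div int p * int p + ?m" by simp
  ultimately show "int t = q * int p + int r \<and> r \<in> {1..p}"
    using h unfolding qt_def rt_def by auto
qed

definition gt :: "nat \<Rightarrow> int \<Rightarrow> int \<Rightarrow> nat \<Rightarrow> int" where
  "gt p m0 d t = qt p t * (m0 + int p * d) + (m0 + int (rt p t) * d)"

definition u_index :: "nat \<Rightarrow> int \<Rightarrow> int \<Rightarrow> int \<Rightarrow> nat" where
  "u_index p m0 d n = (LEAST t. gt p m0 d t \<notin> Ap (H_full p m0 d n) m0)"

definition v_index :: "nat \<Rightarrow> int \<Rightarrow> int \<Rightarrow> int \<Rightarrow> nat" where
  "v_index p m0 d n = (LEAST b. b \<ge> 1 \<and> int b * n \<in> H_arith p m0 d n)"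

text \<open>\<open>\<gamma>\<^sub>k\<close>, where \<open>q = q\<^sub>u\<close> and \<open>r = r\<^sub>u\<close>. The index of \<open>g\<close> equals \<open>u - p + k - 1\<close> and can be
  negative for small \<open>k\<close>, but not for \<open>k \<ge> p - r + 2\<close> if \<open>q \<ge> 0\<close>.\<close>
definition gamma_k :: "nat \<Rightarrow> int \<Rightarrow> int \<Rightarrow> int \<Rightarrow> nat \<Rightarrow> int" where
  "gamma_k p m0 d n k =
     (let u = u_index p m0 d n; v = v_index p m0 d n; q = qt p u; r = rt p u
      in gt p m0 d (nat ((q - 1) * int p + int r + int k - 1)) + (int v - 1) * n - m0)"

end

theory Submission
  imports Defs
begin

text \<open>The rows of an RF-matrix for \<open>f\<close> express \<open>f + a\<^sub>i\<close> as an element of the semigroup for every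
  generator \<open>a\<^sub>i\<close>, so once the rows are verified, \<open>f\<close> is pseudo-Frobenius as soon as \<open>f \<notin> H\<close>.
  For \<open>f = \<gamma>\<^sub>k = g\<^sub>t + (v - 1) n - m\<^sub>0\<close> with \<open>t < u\<close>, the relations for \<open>g\<^sub>u\<close> and \<open>v n\<close> bring an element
  of \<open>H\<close> to the form \<open>a m\<^sub>0 + g\<^sub>s + c n\<close> with \<open>s < u\<close> and \<open>c < v\<close>. If this equals \<open>\<gamma>\<^sub>k\<close>, then, with
  \<open>b = v - 1 - c\<close>, either \<open>b n\<close> lies in \<open>H'\<close> (if \<open>t \<le> s\<close>) or \<open>g\<^bsub>t-s\<^esub> + b n\<close> is a positive multiple of
  \<open>m\<^sub>0\<close> (if \<open>s < t\<close>), contradicting the minimality of \<open>v\<close> or \<open>u\<close>.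
  If \<open>\<mu> = 0\<close>, then \<open>v n = g\<^sub>z\<close> forces \<open>z > 0\<close>, hence \<open>w = 0\<close>, and minimality of the generators
  gives \<open>q\<^sub>z \<ge> 1\<close>, which is what row \<open>n\<close> needs.\<close>

section \<open>Spans with natural coefficients, minimal generators and pseudo-Frobenius
  elements\<close>

lemma nat_span_zero: "0 \<in> nat_span a I"
  unfolding nat_span_def by (rule CollectI, rule exI[of _ "\<lambda>_. 0"]) simp

lemma nat_span_add:
  assumes "x \<in> nat_span a I" and "y \<in> nat_span a I"
  shows "x + y \<in> nat_span a I"
proof -
  obtain b c where "x = (\<Sum>i\<in>I. int (b i) * a i)" "y = (\<Sum>i\<in>I. int (c i) * a i)"
    using assms unfolding nat_span_def by blast
  then have "x + y = (\<Sum>i\<in>I. int (b i + c i) * a i)"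
    by (simp add: sum.distrib distrib_right)
  then show ?thesis
    unfolding nat_span_def by (intro CollectI exI[of _ "\<lambda>i. b i + c i"]) simp
qed

lemma nat_span_scale:
  assumes "x \<in> nat_span a I"
  shows "int k * x \<in> nat_span a I"
  by (induction k) (auto simp: nat_span_zero distrib_right intro: nat_span_add assms)

lemma nat_span_generator:
  assumes "finite I" and "i \<in> I"
  shows "a i \<in> nat_span a I"
proof -
  have "(\<Sum>j\<in>I. int (if j = i then 1 else 0) * a j) = (\<Sum>j\<in>I. if j = i then a j else 0)"
    by (rule sum.cong) auto
  also have "\<dots> = a i"
    using assms by simp
  finally show ?thesis
    unfolding nat_span_def by (intro CollectI exI[of _ "\<lambda>j. if j = i then 1 else 0"]) simp
qed

lemma nat_span_sum:
  assumes "\<And>i. i \<in> I \<Longrightarrow> b i \<in> nat_span a J"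
  shows "(\<Sum>i\<in>I. int (c i) * b i) \<in> nat_span a J"
  using assms
  by (induction I rule: infinite_finite_induct)
    (auto simp: nat_span_zero intro!: nat_span_add nat_span_scale)

lemma nat_span_subsetI:
  assumes "\<And>i. i \<in> I \<Longrightarrow> a i \<in> nat_span a J"
  shows "nat_span a I \<subseteq> nat_span a J"
  using nat_span_sum[of I a a J] assms unfolding nat_span_def[of a I] by auto

lemma minimal_generator_notin_span:
  assumes "minimally_generates a I H" and "finite I" and "j \<in> I"
  shows "a j \<notin> nat_span a (I - {j})"
proof
  assume j: "a j \<in> nat_span a (I - {j})"
  have "nat_span a I \<subseteq> nat_span a (I - {j})"
    using j nat_span_generator[of "I - {j}"] assms(2)
    by (intro nat_span_subsetI) (metis Diff_iff finite_Diff singletonD)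
  moreover have "nat_span a (I - {j}) \<subseteq> nat_span a I"
    using assms(2) by (intro nat_span_subsetI) (auto intro: nat_span_generator)
  ultimately have "nat_span a (I - {j}) = H"
    using assms(1) unfolding minimally_generates_def by auto
  moreover have "I - {j} \<subset> I"
    using assms(3) by auto
  ultimately show False
    using assms(1) unfolding minimally_generates_def by blast
qed

text \<open>A nonzero \<open>h\<close> uses some generator \<open>a j\<close>; \<open>f\<close>
  absorbs one copy of it, and the rest of \<open>h\<close> stays in the span.\<close>

lemma PF_of_generators:
  assumes "finite I" and "f \<notin> nat_span a I" and "\<And>i. i \<in> I \<Longrightarrow> f + a i \<in> nat_span a I"
  shows "f \<in> PF (nat_span a I)"
proof -
  have "f + h \<in> nat_span a I" if h: "h \<in> nat_span a I" "h \<noteq> 0" for h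
  proof -
    obtain c where c: "h = (\<Sum>i\<in>I. int (c i) * a i)"
      using h unfolding nat_span_def by blast
    have "\<exists>j\<in>I. c j \<noteq> 0"
    proof (rule ccontr)
      assume "\<not> (\<exists>j\<in>I. c j \<noteq> 0)"
      then have "h = 0"
        unfolding c by (intro sum.neutral) simp
      then show False
        using h(2) by contradiction
    qed
    then obtain j where j: "j \<in> I" "c j \<noteq> 0"
      by blast
    have "h = int (c j) * a j + (\<Sum>i\<in>I - {j}. int (c i) * a i)"
      unfolding c by (rule sum.remove[OF assms(1) j(1)])
    moreover have "int (c j) * a j = a j + int (c j - 1) * a j"
      using j(2) by (simp add: of_nat_diff left_diff_distrib)
    ultimately have "f + h = (f + a j) + (int (c j - 1) * a j + (\<Sum>i\<in>I - {j}. int (c i) * a i))"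
      by linarith
    moreover have "(\<Sum>i\<in>I - {j}. int (c i) * a i) \<in> nat_span a I"
      using assms(1) by (intro nat_span_sum) (auto intro: nat_span_generator)
    ultimately show ?thesis
      using nat_span_add[OF assms(3)[OF j(1)] nat_span_add[OF nat_span_scale]]
        nat_span_generator[OF assms(1) j(1)] by metis
  qed
  then show ?thesis
    using assms(2) unfolding PF_def by auto
qed

lemma is_RF_matrixI:
  assumes "f \<notin> nat_span a {..<N}" and "A \<in> carrier_mat N N"
    and "\<And>i. i < N \<Longrightarrow> A $$ (i, i) = -1"
    and "\<And>i j. i < N \<Longrightarrow> j < N \<Longrightarrow> i \<noteq> j \<Longrightarrow> A $$ (i, j) \<ge> 0"
    and "\<And>i. i < N \<Longrightarrow> (\<Sum>j<N. A $$ (i, j) * a j) = f"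
  shows "is_RF_matrix N a f A"
proof -
  have "f + a i \<in> nat_span a {..<N}" if i: "i < N" for i
  proof -
    have "f = A $$ (i, i) * a i + (\<Sum>j\<in>{..<N} - {i}. A $$ (i, j) * a j)"
      using assms(5)[OF i] sum.remove[of "{..<N}" i "\<lambda>j. A $$ (i, j) * a j"] i by simp
    \<comment> \<open>The diagonal entry -1 moves to the other side; the remaining coefficients are
      nonnegative.\<close>
    then have "f + a i = (\<Sum>j\<in>{..<N} - {i}. A $$ (i, j) * a j)"
      using assms(3)[OF i] by simp
    also have "\<dots> = (\<Sum>j\<in>{..<N} - {i}. int (nat (A $$ (i, j))) * a j)"
      using i assms(4) by (intro sum.cong) auto
    also have "\<dots> \<in> nat_span a {..<N}"
      by (intro nat_span_sum nat_span_generator) auto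
    finally show ?thesis .
  qed
  then have "f \<in> PF (nat_span a {..<N})"
    using assms(1) by (intro PF_of_generators) auto
  then show ?thesis
    using assms unfolding is_RF_matrix_def by blast
qed

section \<open>Division with remainder in [1, p] and the sequence g\<close>

lemma qt_rt:
  assumes "p \<ge> 1"
  shows "int t = qt p t * int p + int (rt p t)" and "rt p t \<ge> 1" and "rt p t \<le> p"
proof -
  have *: "int t = qt p t * int p + int (rt p t) \<and> rt p t \<in> {1..p}"
    using qt_rt_iff[OF assms] by blast
  show "int t = qt p t * int p + int (rt p t)"
    using * by (rule conjunct1)
  show "rt p t \<ge> 1" "rt p t \<le> p"
    using conjunct2[OF *] by simp_all
qed

text \<open>This identifies \<open>qt p t + 1\<close> as the ceiling of t/p; the estimates on
  \<open>qt\<close> below are derived from it.\<close>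

lemma qt_less_iff:
  assumes "p \<ge> 1"
  shows "qt p t < k \<longleftrightarrow> int t \<le> k * int p"
proof
  note t = qt_rt[OF assms, of t]
  show "int t \<le> k * int p" if "qt p t < k"
  proof -
    have "(qt p t + 1) * int p \<le> k * int p"
      using that by (intro mult_right_mono) auto
    then show ?thesis
      using t by (simp add: distrib_right)
  qed
  show "qt p t < k" if "int t \<le> k * int p"
  proof (rule ccontr)
    assume "\<not> qt p t < k"
    then have "k * int p \<le> qt p t * int p"
      by (intro mult_right_mono) auto
    then show False
      using t that by linarith
  qed
qed

lemma qt_nonneg:
  assumes "p \<ge> 1" and "t \<ge> 1"
  shows "qt p t \<ge> 0"
  using qt_less_iff[OF assms(1), of t 0] assms(2) by auto

lemma qt_ge_minus_1:
  assumes "p \<ge> 1"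
  shows "qt p t \<ge> -1"
proof -
  have "\<not> int t \<le> - 1 * int p"
    using assms by simp
  then show ?thesis
    using qt_less_iff[OF assms, of t "-1"] by linarith
qed

lemma qt_rt_0:
  assumes "p \<ge> 1"
  shows "qt p 0 = -1" and "rt p 0 = p"
  using qt_rt_iff[OF assms, of 0 "-1" p] assms by auto

lemma qt_add:
  assumes "p \<ge> 1"
  shows "qt p (s + t) \<le> qt p s + qt p t + 1" and "qt p s + qt p t \<le> qt p (s + t)"
proof -
  note s = qt_rt[OF assms, of s] and t = qt_rt[OF assms, of t]
  have "int (s + t) \<le> (qt p s + qt p t + 2) * int p"
    using s t by (simp add: algebra_simps)
  then show "qt p (s + t) \<le> qt p s + qt p t + 1"
    using qt_less_iff[OF assms, of "s + t" "qt p s + qt p t + 2"] by linarith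
  have "\<not> int (s + t) \<le> (qt p s + qt p t) * int p"
    using s t by (simp add: algebra_simps)
  then show "qt p s + qt p t \<le> qt p (s + t)"
    using qt_less_iff[OF assms, of "s + t" "qt p s + qt p t"] by linarith
qed

text \<open>As ceil(t/p) is the least number of generators m_i with index sum t, this form shows g_t
  as the cheapest element with d-part t.\<close>

lemma gt_eq:
  assumes "p \<ge> 1"
  shows "gt p m0 d t = (qt p t + 1) * m0 + int t * d"
  unfolding gt_def by (subst qt_rt(1)[OF assms, of t]) (simp add: algebra_simps)

lemma gt_0:
  assumes "p \<ge> 1"
  shows "gt p m0 d 0 = 0"
  using gt_eq[OF assms] qt_rt_0[OF assms] by simp

text \<open>The carry \<open>x\<close> is the rounding gap ceil(s/p) + ceil(t/p) - ceil((s+t)/p),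
  the only obstruction to additivity of g.\<close>

lemma gt_add:
  assumes "p \<ge> 1"
  obtains x where "x \<in> {0, 1}" and "gt p m0 d s + gt p m0 d t = gt p m0 d (s + t) + x * m0"
proof
  show "qt p s + qt p t + 1 - qt p (s + t) \<in> {0, 1}"
    using qt_add[OF assms, of s t] by auto
  show "gt p m0 d s + gt p m0 d t
      = gt p m0 d (s + t) + (qt p s + qt p t + 1 - qt p (s + t)) * m0"
    by (simp add: gt_eq[OF assms] algebra_simps)
qed

section \<open>Membership in H' and H\<close>

text \<open>Greedy choice: peel off the generator of the largest admissible index
  \<open>min s p\<close>; what is left of \<open>s\<close> fits into \<open>k\<close> further
  generators.\<close>

lemma progression_mem_H_arith:
  assumes "s \<le> k * p"
  shows "int k * m0 + int s * d \<in> H_arith p m0 d n"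
  using assms
proof (induction k arbitrary: s)
  case 0
  then show ?case by (simp add: H_arith_def nat_span_zero)
next
  case (Suc k)
  define i where "i = min s p"
  have "int k * m0 + int (s - i) * d \<in> H_arith p m0 d n"
    using Suc.prems by (intro Suc.IH) (auto simp: i_def)
  moreover have "m0 + int i * d \<in> H_arith p m0 d n"
    using nat_span_generator[of "{..p}" i "gens p m0 d n"]
    by (simp add: H_arith_def gens_def i_def)
  ultimately have "(int k * m0 + int (s - i) * d) + (m0 + int i * d) \<in> H_arith p m0 d n"
    unfolding H_arith_def by (rule nat_span_add)
  moreover have "(int k * m0 + int (s - i) * d) + (m0 + int i * d) = int (Suc k) * m0 + int s * d"
    by (simp add: i_def of_nat_diff algebra_simps)
  ultimately show ?case by metis
qed

text \<open>A sum of k generators with index sum s equals k m0 + s d with s <= k p. The excess of k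
  over ceil(s/p) becomes the coefficient of m0.\<close>

lemma H_arith_iff:
  assumes "p \<ge> 1"
  shows "x \<in> H_arith p m0 d n \<longleftrightarrow> (\<exists>a s. x = int a * m0 + gt p m0 d s)"
proof
  assume "x \<in> H_arith p m0 d n"
  then obtain c where "x = (\<Sum>i\<le>p. int (c i) * (m0 + int i * d))"
    unfolding H_arith_def nat_span_def gens_def by auto
  then have x: "x = int (\<Sum>i\<le>p. c i) * m0 + int (\<Sum>i\<le>p. c i * i) * d"
    by (simp add: sum.distrib sum_distrib_right distrib_left mult.assoc)
  define k s where "k = (\<Sum>i\<le>p. c i)" and "s = (\<Sum>i\<le>p. c i * i)"
  have "s \<le> k * p"
    unfolding k_def s_def sum_distrib_right by (rule sum_mono) simp
  then have "int s \<le> int k * int p"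
    by (metis of_nat_le_iff of_nat_mult)
  then have "qt p s < int k"
    using qt_less_iff[OF assms] by blast
  then have "x = int (nat (int k - qt p s - 1)) * m0 + gt p m0 d s"
    using x unfolding gt_eq[OF assms] k_def[symmetric] s_def[symmetric]
    by (simp add: algebra_simps)
  then show "\<exists>a s. x = int a * m0 + gt p m0 d s" by blast
next
  assume "\<exists>a s. x = int a * m0 + gt p m0 d s"
  then obtain a s where x: "x = int a * m0 + gt p m0 d s" by blast
  define k where "k = nat (int a + qt p s + 1)"
  have k: "int k = int a + qt p s + 1"
    using qt_ge_minus_1[OF assms, of s] by (simp add: k_def)
  then have "int s \<le> int k * int p"
    using qt_less_iff[OF assms, of s "int k"] by linarith
  then have "s \<le> k * p"
    by (metis of_nat_le_iff of_nat_mult)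
  moreover have "x = int k * m0 + int s * d"
    unfolding x gt_eq[OF assms] k by (simp add: algebra_simps)
  ultimately show "x \<in> H_arith p m0 d n"
    using progression_mem_H_arith by blast
qed

lemma H_full_iff:
  "x \<in> H_full p m0 d n \<longleftrightarrow> (\<exists>h\<in>H_arith p m0 d n. \<exists>c. x = h + int c * n)"
proof
  have set_eq: "{..<p + 2} = insert (p + 1) {..p}" by auto
  show "\<exists>h\<in>H_arith p m0 d n. \<exists>c. x = h + int c * n" if "x \<in> H_full p m0 d n"
  proof -
    from that obtain c where c: "x = (\<Sum>i\<in>{..<p + 2}. int (c i) * gens p m0 d n i)"
      unfolding H_full_def nat_span_def by blast
    have "x = (\<Sum>i\<le>p. int (c i) * gens p m0 d n i) + int (c (p + 1)) * n"
      unfolding c set_eq by (simp add: gens_def)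
    then show ?thesis
      unfolding H_arith_def nat_span_def by blast
  qed
  show "x \<in> H_full p m0 d n" if ex: "\<exists>h\<in>H_arith p m0 d n. \<exists>c. x = h + int c * n"
  proof -
    obtain h c where h: "h \<in> H_arith p m0 d n" and x: "x = h + int c * n"
      using ex by blast
    have "H_arith p m0 d n \<subseteq> H_full p m0 d n"
      unfolding H_arith_def H_full_def by (intro nat_span_subsetI nat_span_generator) auto
    moreover have "n \<in> H_full p m0 d n"
      unfolding H_full_def
      using nat_span_generator[of "{..<p + 2}" "p + 1" "gens p m0 d n"] by (simp add: gens_def)
    ultimately show ?thesis
      using h x unfolding H_full_def by (auto intro!: nat_span_add nat_span_scale)
  qed
qed

lemma mem_H_arithI:
  assumes "p \<ge> 1" and "a \<ge> 0"
  shows "a * m0 + gt p m0 d s \<in> H_arith p m0 d n"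
proof -
  have "int (nat a) * m0 + gt p m0 d s \<in> H_arith p m0 d n"
    unfolding H_arith_iff[OF assms(1)] by blast
  then show ?thesis
    using assms(2) by simp
qed

lemma mem_H_fullI:
  assumes "p \<ge> 1" and "a \<ge> 0" and "c \<ge> 0"
  shows "a * m0 + gt p m0 d s + c * n \<in> H_full p m0 d n"
  unfolding H_full_iff
  using mem_H_arithI[OF assms(1,2)] assms(3) by (metis int_nat_eq)

lemma H_full_cases:
  assumes "p \<ge> 1" and "x \<in> H_full p m0 d n"
  obtains a s c where "x = int a * m0 + gt p m0 d s + int c * n"
proof -
  obtain h c where h: "h \<in> H_arith p m0 d n" and x: "x = h + int c * n"
    using assms(2) unfolding H_full_iff by blast
  obtain a s where "h = int a * m0 + gt p m0 d s"
    using h unfolding H_arith_iff[OF assms(1)] by blast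
  then show thesis
    using that x by blast
qed

section \<open>Normal forms modulo the relations for g_u and v n\<close>

text \<open>Each subtraction of \<open>u\<close> from the index yields \<open>lam - x\<close> copies
  of m0, which is nonnegative because x <= 1 <= \<open>lam\<close>. The n-coefficient is kept as a
  multiple of \<open>w\<close>, so that it vanishes when w = 0.\<close>

lemma gt_reduce:
  assumes "p \<ge> 1" and "u \<ge> 1" and "lam \<ge> 1" and "gt p m0 d u = lam * m0 + int w * n"
  shows "\<exists>a s' c. s' < u \<and> gt p m0 d s = int a * m0 + gt p m0 d s' + int (c * w) * n"
proof (induction s rule: less_induct)
  case (less s)
  show ?case
  proof (cases "s < u")
    case True
    then show ?thesis by (intro exI[of _ 0] exI[of _ s]) simp
  next
    case False
    then obtain a s' c where IH: "s' < u"
        "gt p m0 d (s - u) = int a * m0 + gt p m0 d s' + int (c * w) * n"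
      using less.IH[of "s - u"] assms(2) by auto
    obtain x where x: "x \<in> {0, 1}" "gt p m0 d (s - u) + gt p m0 d u = gt p m0 d (s - u + u) + x * m0"
      using gt_add[OF assms(1)] by blast
    have "gt p m0 d s = int (a + nat (lam - x)) * m0 + gt p m0 d s' + int ((c + 1) * w) * n"
      using x IH(2) assms(3,4) False by (auto simp: algebra_simps)
    then show ?thesis
      using IH(1) by blast
  qed
qed

text \<open>The two cases of the hypothesis \<open>z = 0 \<or> w = 0\<close> eliminate the relations for \<open>g\<^sub>u\<close> and
  \<open>v n\<close> in opposite orders: the relation used second must not create new terms of the first kind.\<close>

lemma H_full_normal_form:
  assumes "p \<ge> 1" and "u \<ge> 1" and "v \<ge> 1" and "lam \<ge> 1" and "mu \<ge> 0"
    and gu: "gt p m0 d u = lam * m0 + int w * n"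
    and vn: "int v * n = mu * m0 + gt p m0 d z"
    and "z = 0 \<or> w = 0"
    and "x \<in> H_full p m0 d n"
  shows "\<exists>a s c. s < u \<and> c < v \<and> x = int a * m0 + gt p m0 d s + int c * n"
proof -
  obtain a s c where x: "x = int a * m0 + gt p m0 d s + int c * n"
    using H_full_cases[OF assms(1,9)] by blast
  have split: "int e * n = int (e div v) * (int v * n) + int (e mod v) * n" for e
  proof -
    have "int e * n = int (e div v * v + e mod v) * n"
      by simp
    then show ?thesis
      by (simp only: of_nat_add of_nat_mult distrib_right mult.assoc)
  qed
  show ?thesis
  proof (cases "w = 0")
    case True
    \<comment> \<open>Reduce the n-coefficient first: multiples of v n are absorbed into H', and
      since w = 0 the later reduction of g creates no new n.\<close>
    have "int v * n \<in> H_arith p m0 d n"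
      unfolding vn using mem_H_arithI[OF assms(1,5)] .
    then have "int (c div v) * (int v * n) \<in> H_arith p m0 d n"
      unfolding H_arith_def by (rule nat_span_scale)
    moreover have "int a * m0 + gt p m0 d s \<in> H_arith p m0 d n"
      unfolding H_arith_iff[OF assms(1)] by blast
    ultimately have "int a * m0 + gt p m0 d s + int (c div v) * (int v * n) \<in> H_arith p m0 d n"
      unfolding H_arith_def by (rule nat_span_add[rotated])
    then obtain b t where bt:
        "int a * m0 + gt p m0 d s + int (c div v) * (int v * n) = int b * m0 + gt p m0 d t"
      unfolding H_arith_iff[OF assms(1)] by blast
    obtain b' t' where t': "t' < u" "gt p m0 d t = int b' * m0 + gt p m0 d t'"
      using gt_reduce[OF assms(1,2,4) gu, of t] True by auto
    have "x = int (b + b') * m0 + gt p m0 d t' + int (c mod v) * n"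
      using x bt t'(2) split[of c] by (simp add: algebra_simps)
    then show ?thesis
      using t'(1) assms(3) by (metis less_eq_Suc_le mod_less_divisor One_nat_def)
  next
    case False
    \<comment> \<open>Here z = 0, so reducing the n-coefficient last creates only copies of m0 and
      leaves g_t intact.\<close>
    then have vn': "int v * n = mu * m0"
      using assms(8) vn gt_0[OF assms(1)] by simp
    obtain b t e where t: "t < u" "gt p m0 d s = int b * m0 + gt p m0 d t + int (e * w) * n"
      using gt_reduce[OF assms(1,2,4) gu] by blast
    define f where "f = e * w + c"
    have "x = int a * m0 + int b * m0 + gt p m0 d t + int f * n"
      using x t(2) by (simp add: f_def algebra_simps)
    also have "\<dots> = int (a + b + f div v * nat mu) * m0 + gt p m0 d t + int (f mod v) * n"
      using assms(5) unfolding split[of f] vn' by (simp add: algebra_simps)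
    finally show ?thesis
      using t(1) assms(3) by (metis less_eq_Suc_le mod_less_divisor One_nat_def)
  qed
qed

section \<open>Minimality of u and v, and elements outside H\<close>

lemma gt_below_u_index:
  assumes "t < u_index p m0 d n"
  shows "gt p m0 d t - m0 \<notin> H_full p m0 d n"
  using not_less_Least[OF assms[unfolded u_index_def]] by (simp add: Ap_def)

lemma multiple_below_v_index:
  assumes "b < v_index p m0 d n" and "int b * n \<in> H_arith p m0 d n"
  shows "b = 0"
  using not_less_Least[OF assms(1)[unfolded v_index_def]] assms(2) by auto

text \<open>Subtract the forbidden equation from g_u = lam m0 (if w = 0) or from v n = mu m0
  (otherwise, as then z = 0). According to the sign of the resulting m0-coefficient, either a
  smaller multiple of n lies in H' or some g_y with 0 < y < u leaves the Apery set.\<close>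

lemma gt_add_multiple_not_multiple_m0:
  assumes "p \<ge> 1" and u: "u = u_index p m0 d n" and v: "v = v_index p m0 d n"
    and gu: "gt p m0 d u = lam * m0 + int w * n"
    and vn: "int v * n = mu * m0 + gt p m0 d z"
    and zw: "z = 0 \<or> w = 0"
    and x: "1 \<le> x" "x < u" and b: "b < v" and a: "a \<ge> 1"
  shows "gt p m0 d x + int b * n \<noteq> a * m0"
proof
  assume eq: "gt p m0 d x + int b * n = a * m0"
  \<comment> \<open>Contradiction with the minimality of \<open>u\<close>; g_0 = 0 fills the place
    of the g-term in \<open>mem_H_fullI\<close>.\<close>
  have not_Ap: False if "1 \<le> a'" "0 \<le> c" "y < u" "gt p m0 d y = a' * m0 + c * n" for a' c y
  proof -
    have "gt p m0 d y - m0 = (a' - 1) * m0 + gt p m0 d 0 + c * n"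
      using that(4) gt_0[OF assms(1)] by (simp add: algebra_simps)
    then have "gt p m0 d y - m0 \<in> H_full p m0 d n"
      using mem_H_fullI[OF assms(1), of "a' - 1" c] that(1,2) by (metis diff_ge_0_iff_ge)
    then show False
      using gt_below_u_index that(3) u by blast
  qed
  have "b \<noteq> 0"
  proof
    assume "b = 0"
    then have "gt p m0 d x = a * m0 + 0 * n"
      using eq by simp
    then show False
      using not_Ap[OF a order_refl x(2)] by blast
  qed
  \<comment> \<open>Contradiction with the minimality of \<open>v\<close>.\<close>
  have not_mult: False if "0 \<le> a'" "1 \<le> c" "c < v" "int c * n = a' * m0 + gt p m0 d y" for a' c y
  proof -
    have "int c * n \<in> H_arith p m0 d n"
      unfolding that(4) using mem_H_arithI[OF assms(1) that(1)] .
    then show False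
      using multiple_below_v_index[of c] that(2,3) v by auto
  qed
  show False
  proof (cases "w = 0")
    case True
    \<comment> \<open>Pass to the complementary index \<open>u - x\<close>, with carry
      \<open>y\<close>.\<close>
    obtain y where y: "y \<in> {0, 1}" "gt p m0 d x + gt p m0 d (u - x) = gt p m0 d (x + (u - x)) + y * m0"
      using gt_add[OF assms(1)] by blast
    have eq2: "int b * n = (a - lam - y) * m0 + gt p m0 d (u - x)"
      using y(2) eq gu True x by (simp add: algebra_simps)
    show False
    proof (cases "a - lam - y \<ge> 0")
      case True
      then show False
        using not_mult[OF True _ b eq2] \<open>b \<noteq> 0\<close> by simp
    next
      case False
      have "gt p m0 d (u - x) = (lam + y - a) * m0 + int b * n"
        using eq2 by (simp add: algebra_simps)
      then show False
        using not_Ap[of "lam + y - a" "int b" "u - x"] False x by auto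
    qed
  next
    case False
    \<comment> \<open>Pass to the complementary multiple \<open>v - b\<close>; it lies strictly
      between 0 and \<open>v\<close> because b is nonzero.\<close>
    then have eq2: "int (v - b) * n = (mu - a) * m0 + gt p m0 d x"
      using zw vn eq b gt_0[OF assms(1)] by (simp add: of_nat_diff algebra_simps)
    show False
    proof (cases "mu - a \<ge> 0")
      case True
      have "1 \<le> v - b" "v - b < v"
        using \<open>b \<noteq> 0\<close> b by auto
      then show False
        using not_mult[OF True _ _ eq2] by blast
    next
      case False
      have "gt p m0 d x = (a - mu) * m0 + int (v - b) * n"
        using eq2 by (simp add: algebra_simps)
      then show False
        using not_Ap[of "a - mu" "int (v - b)" x] False x by auto
    qed
  qed
qed

lemma gt_add_max_multiple_notin:
  assumes "p \<ge> 1" and u: "u = u_index p m0 d n" and v: "v = v_index p m0 d n"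
    and "v \<ge> 1" and "lam \<ge> 1" and "mu \<ge> 0"
    and gu: "gt p m0 d u = lam * m0 + int w * n"
    and vn: "int v * n = mu * m0 + gt p m0 d z"
    and zw: "z = 0 \<or> w = 0"
    and t: "t < u"
  shows "gt p m0 d t + (int v - 1) * n - m0 \<notin> H_full p m0 d n"
proof
  assume "gt p m0 d t + (int v - 1) * n - m0 \<in> H_full p m0 d n"
  then obtain a s c where s: "s < u" and c: "c < v"
      and nf: "gt p m0 d t + (int v - 1) * n - m0 = int a * m0 + gt p m0 d s + int c * n"
    using H_full_normal_form[OF assms(1) _ assms(4-6) gu vn zw] t by (metis less_one not_le less_nat_zero_code)
  define b where "b = v - 1 - c"
  have b: "b < v" "int b = int v - 1 - int c"
    using c by (auto simp: b_def)
  have eq: "gt p m0 d t + int b * n = (int a + 1) * m0 + gt p m0 d s"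
    using nf unfolding b(2) by (simp add: algebra_simps)
  show False
  proof (cases "t \<le> s")
    case True
    obtain x where x: "x \<in> {0, 1}" "gt p m0 d t + gt p m0 d (s - t) = gt p m0 d (t + (s - t)) + x * m0"
      using gt_add[OF assms(1)] by blast
    have "int b * n = (int a + 1 - x) * m0 + gt p m0 d (s - t)"
      using x(2) eq True by (simp add: algebra_simps)
    \<comment> \<open>The coefficient is nonnegative since x <= 1 <= a + 1.\<close>
    then have "int b * n = int (nat (int a + 1 - x)) * m0 + gt p m0 d (s - t)"
      using x(1) by auto
    then have "int b * n \<in> H_arith p m0 d n"
      unfolding H_arith_iff[OF assms(1)] by blast
    \<comment> \<open>This is no contradiction yet: b = 0 turns \<open>eq\<close> into g_t - m0 = a
      m0 + g_s, which contradicts t < u.\<close>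
    then have "b = 0"
      using multiple_below_v_index b(1) v by blast
    then have "gt p m0 d t - m0 = int a * m0 + gt p m0 d s + 0 * n"
      using eq by (simp add: algebra_simps)
    then have "gt p m0 d t - m0 \<in> H_full p m0 d n"
      using mem_H_fullI[OF assms(1), of "int a" 0] by (metis of_nat_0_le_iff order_refl)
    then show False
      using gt_below_u_index t u by blast
  next
    case False
    obtain x where x: "x \<in> {0, 1}" "gt p m0 d s + gt p m0 d (t - s) = gt p m0 d (s + (t - s)) + x * m0"
      using gt_add[OF assms(1)] by blast
    have "gt p m0 d (t - s) + int b * n = (int a + 1 + x) * m0"
      using x(2) eq False by (simp add: algebra_simps)
    moreover have "1 \<le> t - s" "t - s < u" "int a + 1 + x \<ge> 1"
      using False t x(1) by auto
    ultimately show False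
      using gt_add_multiple_not_multiple_m0[OF assms(1) u v gu vn zw _ _ b(1)] by blast
  qed
qed

text \<open>If q_z were 0, then g_z would be the single generator m_{r_z} and a multiple of n, hence
  redundant. The case z = 0 is excluded because g_0 = 0 while v n > 0.\<close>

lemma qt_pos_of_multiple:
  assumes "p \<ge> 1" and "n \<ge> 1" and "v \<ge> 1"
    and min: "minimally_generates (gens p m0 d n) {..<p + 2} (H_full p m0 d n)"
    and vn: "int v * n = gt p m0 d z"
  shows "qt p z \<ge> 1"
proof (rule ccontr)
  assume "\<not> qt p z \<ge> 1"
  moreover have "z \<noteq> 0"
  proof
    assume "z = 0"
    then have "int v * n = 0"
      using vn gt_0[OF assms(1)] by simp
    then show False
      using assms(2,3) by simp
  qed
  ultimately have "qt p z = 0"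
    using qt_nonneg[OF assms(1), of z] by auto
  define j where "j = rt p z"
  have j: "1 \<le> j" "j \<le> p"
    using qt_rt[OF assms(1)] by (auto simp: j_def)
  have "gens p m0 d n j = int v * n"
    using vn \<open>qt p z = 0\<close> j by (simp add: gt_def gens_def j_def)
  moreover have "n \<in> nat_span (gens p m0 d n) ({..<p + 2} - {j})"
    using nat_span_generator[of "{..<p + 2} - {j}" "p + 1" "gens p m0 d n"] j
    by (simp add: gens_def)
  ultimately have "gens p m0 d n j \<in> nat_span (gens p m0 d n) ({..<p + 2} - {j})"
    using nat_span_scale by metis
  then show False
    using minimal_generator_notin_span[OF min] j by simp
qed

section \<open>Rows of RF-matrices\<close>

text \<open>Named so that its linearity rules evaluate rows written as combinations of unit
  vectors.\<close>

definition row_weight :: "nat \<Rightarrow> (nat \<Rightarrow> int) \<Rightarrow> int vec \<Rightarrow> int" where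
  "row_weight N a x = (\<Sum>j<N. x $ j * a j)"

lemma row_weight_simps:
  shows "dim_vec x = N \<Longrightarrow> dim_vec y = N \<Longrightarrow>
      row_weight N a (x + y) = row_weight N a x + row_weight N a y"
    and "dim_vec x = N \<Longrightarrow> dim_vec y = N \<Longrightarrow>
      row_weight N a (x - y) = row_weight N a x - row_weight N a y"
    and "dim_vec x = N \<Longrightarrow> row_weight N a (- x) = - row_weight N a x"
    and "dim_vec x = N \<Longrightarrow> row_weight N a (c \<cdot>\<^sub>v x) = c * row_weight N a x"
    and "k < N \<Longrightarrow> row_weight N a (unit_vec N k) = a k"
proof -
  assume k: "k < N"
  have "row_weight N a (unit_vec N k) = (\<Sum>j<N. if j = k then a j else 0)"
    unfolding row_weight_def using k by (intro sum.cong) auto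
  then show "row_weight N a (unit_vec N k) = a k"
    using k by simp
qed (simp_all add: row_weight_def distrib_right left_diff_distrib sum.distrib sum_subtractf
      sum_negf sum_distrib_left mult.assoc)

definition is_RF_row :: "nat \<Rightarrow> (nat \<Rightarrow> int) \<Rightarrow> int \<Rightarrow> nat \<Rightarrow> int vec \<Rightarrow> bool" where
  "is_RF_row N a f i x \<longleftrightarrow>
     x \<in> carrier_vec N \<and> x $ i = -1 \<and> (\<forall>j<N. j \<noteq> i \<longrightarrow> x $ j \<ge> 0) \<and> row_weight N a x = f"

lemma is_RF_matrix_of_rows:
  assumes "f \<notin> nat_span a {..<N}" and "\<And>i. i < N \<Longrightarrow> is_RF_row N a f i (R i)"
  obtains A where "is_RF_matrix N a f A" and "\<And>i. i < N \<Longrightarrow> row A i = R i"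
proof
  let ?A = "mat N N (\<lambda>(i, j). R i $ j)"
  show "is_RF_matrix N a f ?A"
    using assms unfolding is_RF_row_def row_weight_def by (intro is_RF_matrixI) auto
  show "row ?A i = R i" if "i < N" for i
    using assms(2)[OF that] that unfolding is_RF_row_def by (intro eq_vecI) auto
qed

lemma unit_vec_index:
  assumes "j < N"
  shows "unit_vec N i $ j = (if j = i then 1 else 0)"
  using assms unfolding unit_vec_def by simp

section \<open>Verification of the four types of rows\<close>

theorem proposition3p4:
  fixes p u v z w r :: nat and m0 d n lam mu q :: int and E :: "nat \<Rightarrow> int vec"
  assumes "p \<ge> 1" and "d \<ge> 1" and "m0 \<ge> 1" and "n \<ge> 1"
    and "gcd m0 (gcd d n) = 1"
    and "minimally_generates (gens p m0 d n) {..<p + 2} (H_full p m0 d n)"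
    and "u = u_index p m0 d n"
    and "v = v_index p m0 d n"
    and "z < u" and "w < v" and "lam \<ge> 1" and "mu \<ge> 0"
    and "gt p m0 d u = lam * m0 + int w * n"
    and "int v * n = mu * m0 + gt p m0 d z"
    and "gt p m0 d (u - z) + int (v - w) * n =
           (if rt p (u - z) < rt p u then lam + mu + 1 else lam + mu) * m0"
    and "q = qt p u" and "r = rt p u"
    and "{u - z..u - 1} \<times> {v - w..v - 1} = {}"
    and "r \<ge> 2"
    and "\<And>i. E i = unit_vec (p + 2) i"
  shows "\<forall>k\<in>{p - r + 2..p}. \<exists>e\<in>{1..p - 1}. r + k + e = 2 * p + 1 \<and>
    (\<exists>A. is_RF_matrix (p + 2) (gens p m0 d n) (gamma_k p m0 d n k) A \<and>
      row A 0 = - E 0 + q \<cdot>\<^sub>v E p + (int v - 1) \<cdot>\<^sub>v E (p + 1) + E (p - e) \<and>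
      (\<forall>j\<in>{1..e}.
        row A j = - E j + q \<cdot>\<^sub>v E p + (int v - 1) \<cdot>\<^sub>v E (p + 1) + E (p - e + j)) \<and>
      (\<forall>j\<in>{e + 1..p}.
        row A j = (lam - 1) \<cdot>\<^sub>v E 0 - E j + (int w + int v - 1) \<cdot>\<^sub>v E (p + 1)
                  + E (k + j - p - 1)) \<and>
      row A (p + 1) =
        (if mu \<ge> 1
         then (mu - 1) \<cdot>\<^sub>v E 0 + (q + qt p z) \<cdot>\<^sub>v E p - E (p + 1) + E (p - e) + E (rt p z)
         else (lam - 1) \<cdot>\<^sub>v E 0 + (qt p z - 1) \<cdot>\<^sub>v E p - E (p + 1) + E (k - 1) + E (rt p z)))"
proof
  fix k assume k: "k \<in> {p - r + 2..p}"
  define e where "e = 2 * p + 1 - r - k"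
  define a where "a = gens p m0 d n"
  define f where "f = gamma_k p m0 d n k"
  have r: "2 \<le> r" "r \<le> p"
    using assms(19) qt_rt[OF assms(1), of u] unfolding assms(17) by auto
  have e: "1 \<le> e" "e < p" "r + k + e = 2 * p + 1"
    using k r by (auto simp: e_def)
  have pe: "p - e = r + k - 1 - p" "int (p - e) = int r + int k - 1 - int p"
    using e k r by auto
  have u1: "u \<ge> 1" and v1: "v \<ge> 1"
    using assms(9,10) by auto
  have q: "q \<ge> 0"
    using qt_nonneg[OF assms(1) u1] assms(16) by simp
  have u_eq: "int u = q * int p + int r"
    unfolding assms(16,17) by (rule qt_rt(1)[OF assms(1)])
  have zw: "z = 0 \<or> w = 0"
  proof (rule ccontr)
    assume "\<not> (z = 0 \<or> w = 0)"
    then have "(u - 1, v - 1) \<in> {u - z..u - 1} \<times> {v - w..v - 1}"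
      by auto
    then show False
      unfolding assms(18) by blast
  qed
  \<comment> \<open>The index of g in \<open>gamma_k\<close>. It equals q p + (p - e), so the
    truncation by \<open>nat\<close> is harmless and p - e in [1, p] is its remainder.\<close>
  define t where "t = nat ((q - 1) * int p + int r + int k - 1)"
  have t_eq: "int t = q * int p + int (p - e)"
  proof -
    have "(q - 1) * int p + int r + int k - 1 = q * int p + int (p - e)"
      unfolding pe(2) by (simp add: algebra_simps)
    then show ?thesis
      unfolding t_def using q by simp
  qed
  have "t < u"
    using t_eq u_eq pe(2) k by auto
  have "q = qt p t \<and> p - e = rt p t"
    using qt_rt_iff[OF assms(1), of t q "p - e"] t_eq e by auto
  then have gt_t: "gt p m0 d t = q * (m0 + int p * d) + (m0 + int (p - e) * d)"
    unfolding gt_def by simp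
  have f_gt: "f = gt p m0 d t + (int v - 1) * n - m0"
    unfolding f_def gamma_k_def Let_def t_def assms(7,8,16,17) by simp
  \<comment> \<open>The subtracted m0 cancels the one inside m_{p-e}; all row weights are compared
    with this form.\<close>
  have f_eq: "f = q * (m0 + int p * d) + int (p - e) * d + (int v - 1) * n"
    unfolding f_gt gt_t by simp
  have f_notin: "f \<notin> nat_span a {..<p + 2}"
    using gt_add_max_multiple_notin[OF assms(1,7,8) v1 assms(11-14) zw \<open>t < u\<close>]
    unfolding f_gt H_full_def a_def .
  have gu: "lam * m0 + int w * n = q * (m0 + int p * d) + (m0 + int r * d)"
    using assms(13) unfolding gt_def assms(16,17) by simp
  have vn: "int v * n = mu * m0 + qt p z * (m0 + int p * d) + (m0 + int (rt p z) * d)"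
    using assms(14) unfolding gt_def by simp
  have a: "a i = m0 + int i * d" if "i \<le> p" for i
    using that by (simp add: a_def gens_def)
  have an: "a (p + 1) = n" "a (Suc p) = n"
    by (simp_all add: a_def gens_def)
  note rz = qt_rt[OF assms(1), of z]
  note row_simps = is_RF_row_def assms(20) row_weight_simps unit_vec_index a an

  have row0: "is_RF_row (p + 2) a f 0
      (- E 0 + q \<cdot>\<^sub>v E p + (int v - 1) \<cdot>\<^sub>v E (p + 1) + E (p - e))"
    using e q v1 r by (auto simp: row_simps f_eq algebra_simps)
  \<comment> \<open>Replacing m_j by m_{p-e+j} adds (p - e) d; the bound j <= e keeps the new index
    at most p.\<close>
  have row_low: "is_RF_row (p + 2) a f j
      (- E j + q \<cdot>\<^sub>v E p + (int v - 1) \<cdot>\<^sub>v E (p + 1) + E (p - e + j))" if "j \<in> {1..e}" for j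
    using that e q v1 r by (auto simp: row_simps f_eq algebra_simps)
  have row_high: "is_RF_row (p + 2) a f j
      ((lam - 1) \<cdot>\<^sub>v E 0 - E j + (int w + int v - 1) \<cdot>\<^sub>v E (p + 1) + E (k + j - p - 1))"
    if j: "j \<in> {e + 1..p}" for j
  proof -
    \<comment> \<open>From j > e the index is at least p + 1 - r >= 1, and from k <= p it is below
      j, so the unit vector avoids column 0 and the diagonal.\<close>
    have l: "1 \<le> k + j - p - 1" "k + j - p - 1 < j" "int (k + j - p - 1) = int k + int j - int p - 1"
      using j k e r by auto
    have "(lam - 1) * m0 - (m0 + int j * d) + (int w + int v - 1) * n
        + (m0 + int (k + j - p - 1) * d) = f"
      using gu unfolding f_eq l(3) pe(2) by (simp add: algebra_simps)
    then show ?thesis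
      using j l(1,2) assms(11) v1 by (auto simp: row_simps)
  qed
  have row_n_pos: "is_RF_row (p + 2) a f (p + 1)
      ((mu - 1) \<cdot>\<^sub>v E 0 + (q + qt p z) \<cdot>\<^sub>v E p - E (p + 1) + E (p - e) + E (rt p z))"
    if mu: "mu \<ge> 1"
  proof -
    \<comment> \<open>For z = 0 one has q_z = -1, so the coefficient of \<open>E p\<close> may be
      -1; then r_z = p and the summand \<open>E (rt p z)\<close> compensates.\<close>
    have "q + qt p z \<ge> 0 \<or> q + qt p z = -1 \<and> rt p z = p"
      using q qt_nonneg[OF assms(1), of z] qt_rt_0[OF assms(1)] by (cases "z = 0") auto
    moreover have "(mu - 1) * m0 + (q + qt p z) * (m0 + int p * d) - n + (m0 + int (p - e) * d)
        + (m0 + int (rt p z) * d) = f"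
      using vn unfolding f_eq by (simp add: algebra_simps)
    ultimately show ?thesis
      using mu rz e by (auto simp: row_simps)
  qed
  have row_n_zero: "is_RF_row (p + 2) a f (p + 1)
      ((lam - 1) \<cdot>\<^sub>v E 0 + (qt p z - 1) \<cdot>\<^sub>v E p - E (p + 1) + E (k - 1) + E (rt p z))"
    if mu: "\<not> mu \<ge> 1"
  proof -
    have "mu = 0"
      using mu assms(12) by simp
    then have "int v * n = gt p m0 d z"
      using assms(14) by simp
    then have "qt p z \<ge> 1"
      using qt_pos_of_multiple[OF assms(1,4) v1 assms(6)] by blast
    \<comment> \<open>q_0 = -1 rules out z = 0. With w = 0 the relation for g_u has no n-term, so it
      trades lam m0 for q m_p + m_r.\<close>
    then have "w = 0"
      using zw qt_rt_0[OF assms(1)] by auto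
    have k1: "k - 1 \<le> p" "int (k - 1) = int k - 1"
      using k by auto
    have "(lam - 1) * m0 + (qt p z - 1) * (m0 + int p * d) - n + (m0 + int (k - 1) * d)
        + (m0 + int (rt p z) * d) = f"
      using vn gu \<open>mu = 0\<close> \<open>w = 0\<close> unfolding f_eq k1(2) pe(2) by (simp add: algebra_simps)
    then show ?thesis
      using \<open>qt p z \<ge> 1\<close> assms(11) rz k1(1) by (auto simp: row_simps)
  qed

  define R where "R i =
    (if i = 0 then - E 0 + q \<cdot>\<^sub>v E p + (int v - 1) \<cdot>\<^sub>v E (p + 1) + E (p - e)
     else if i \<le> e then - E i + q \<cdot>\<^sub>v E p + (int v - 1) \<cdot>\<^sub>v E (p + 1) + E (p - e + i)
     else if i \<le> p then (lam - 1) \<cdot>\<^sub>v E 0 - E i + (int w + int v - 1) \<cdot>\<^sub>v E (p + 1)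
       + E (k + i - p - 1)
     else if mu \<ge> 1
     then (mu - 1) \<cdot>\<^sub>v E 0 + (q + qt p z) \<cdot>\<^sub>v E p - E (p + 1) + E (p - e) + E (rt p z)
     else (lam - 1) \<cdot>\<^sub>v E 0 + (qt p z - 1) \<cdot>\<^sub>v E p - E (p + 1) + E (k - 1) + E (rt p z))" for i
  have R: "is_RF_row (p + 2) a f i (R i)" if "i < p + 2" for i
  proof -
    have "i = p + 1" if "\<not> i \<le> p"
      using that \<open>i < p + 2\<close> by simp
    then show ?thesis
      unfolding R_def using row0 row_low[of i] row_high[of i] row_n_pos row_n_zero by auto
  qed
  obtain A where "is_RF_matrix (p + 2) a f A" and A: "\<And>i. i < p + 2 \<Longrightarrow> row A i = R i"
    using is_RF_matrix_of_rows[OF f_notin R] by blast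
  moreover have "e \<in> {1..p - 1}"
    using e by auto
  ultimately show "\<exists>e\<in>{1..p - 1}. r + k + e = 2 * p + 1 \<and>
    (\<exists>A. is_RF_matrix (p + 2) (gens p m0 d n) (gamma_k p m0 d n k) A \<and>
      row A 0 = - E 0 + q \<cdot>\<^sub>v E p + (int v - 1) \<cdot>\<^sub>v E (p + 1) + E (p - e) \<and>
      (\<forall>j\<in>{1..e}.
        row A j = - E j + q \<cdot>\<^sub>v E p + (int v - 1) \<cdot>\<^sub>v E (p + 1) + E (p - e + j)) \<and>
      (\<forall>j\<in>{e + 1..p}.
        row A j = (lam - 1) \<cdot>\<^sub>v E 0 - E j + (int w + int v - 1) \<cdot>\<^sub>v E (p + 1)
                  + E (k + j - p - 1)) \<and>
      row A (p + 1) =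
        (if mu \<ge> 1
         then (mu - 1) \<cdot>\<^sub>v E 0 + (q + qt p z) \<cdot>\<^sub>v E p - E (p + 1) + E (p - e) + E (rt p z)
         else (lam - 1) \<cdot>\<^sub>v E 0 + (qt p z - 1) \<cdot>\<^sub>v E p - E (p + 1) + E (k - 1) + E (rt p z)))"
    using e(2,3) unfolding a_def f_def
    by (intro bexI[of _ e] conjI exI[of _ A]) (simp_all add: A R_def)
qed

end
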